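(* Let $s\ge3$ and $\Gamma_{2,2,s}=\{1324,1423,12\cdots s(s+1)\}$. For $n\ge1$, the coefficient of $y^n$ in $U_{\Gamma_{2,2,s},sn}(-y)$ equals $\prod_{i=1}^n((i-1)s+1)$, and the coefficient of $y^{n+1}$ in $U_{\Gamma_{2,2,s},sn+s-1}(-y)$ equals $\prod_{i=1}^n((i+1)s+1)$.
   Context: $12\cdots s(s+1)$ is the identity of $\mathfrak S_{s+1}$. For $\sigma\in\mathfrak S_n$, $\mathrm{des}(\sigma)$ is the number of $i$ with $\sigma_i>\sigma_{i+1}$. For distinct integers $\alpha=\alpha_1\cdots\alpha_r$, $\mathrm{red}(\alpha)\in\mathfrak S_r$ replaces the $i$-th smallest entry by $i$. $\sigma$ has a $\Gamma$-match starting at position $i$ if there is $j\ge1$ with $\mathrm{red}(\sigma_i\cdots\sigma_{i+j})\in\Gamma$; $\mathcal{NM}_n(\Gamma)$ is the set of $\sigma\in\mathfrak S_n$ with no $\Gamma$-match. The polynomials $U_{\Gamma,n}(y)$ are defined by $\sum_{n\ge0}U_{\Gamma,n}(y)\frac{t^n}{n!}=\left(1+\sum_{n\ge1}\frac{t^n}{n!}\sum_{\sigma\in\mathcal{NM}_n(\Gamma)}y^{1+\mathrm{des}(\sigma)}\right)^{-1}$. *)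

theory Defs
  imports
    "HOL-Computational_Algebra.Computational_Algebra"
    "HOL-Combinatorics.Multiset_Permutations"
begin

text \<open>
  Permutations in one-line notation are lists: the symmetric group on \<open>n\<close> letters is
  \<open>permutations_of_set {1..n}\<close>. List positions are counted from \<open>0\<close>, the entries from \<open>1\<close>.
\<close>

definition des :: "nat list \<Rightarrow> nat" where
  "des \<sigma> = card {i. Suc i < length \<sigma> \<and> \<sigma> ! i > \<sigma> ! Suc i}"

definition red :: "nat list \<Rightarrow> nat list" where
  "red \<alpha> = map (\<lambda>x. card {y \<in> set \<alpha>. y \<le> x}) \<alpha>"

definition match_at :: "nat list set \<Rightarrow> nat list \<Rightarrow> nat \<Rightarrow> bool" where
  "match_at \<Gamma> \<sigma> i \<longleftrightarrow>
     (\<exists>j\<ge>1. i + j < length \<sigma> \<and> red (take (j + 1) (drop i \<sigma>)) \<in> \<Gamma>)"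

definition NM :: "nat list set \<Rightarrow> nat \<Rightarrow> nat list set" where
  "NM \<Gamma> n = {\<sigma> \<in> permutations_of_set {1..n}. \<forall>i. \<not> match_at \<Gamma> \<sigma> i}"

text \<open>Power series in \<open>t\<close> whose coefficients are polynomials in \<open>y\<close>.\<close>

definition NM_egf :: "nat list set \<Rightarrow> rat poly fps" where
  "NM_egf \<Gamma> = 1 + Abs_fps (\<lambda>n. if n = 0 then 0
     else smult (1 / fact n) (\<Sum>\<sigma>\<in>NM \<Gamma> n. monom 1 (1 + des \<sigma>)))"

text \<open>
  The type \<open>rat poly\<close> has no \<open>inverse\<close> operation, so the reciprocal of the series is
  \<open>fps_right_inverse\<close>, whose second argument is the inverse of the constant term.
\<close>

definition U :: "nat list set \<Rightarrow> nat \<Rightarrow> rat poly" where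
  "U \<Gamma> n = smult (fact n) (fps_nth (fps_right_inverse (NM_egf \<Gamma>) 1) n)"

lemma U_egf:
  "NM_egf \<Gamma> * Abs_fps (\<lambda>n. smult (1 / fact n) (U \<Gamma> n)) = 1"
proof -
  have "Abs_fps (\<lambda>n. smult (1 / fact n) (U \<Gamma> n)) = fps_right_inverse (NM_egf \<Gamma>) 1"
    by (rule fps_ext) (simp add: U_def)
  moreover have "NM_egf \<Gamma> * fps_right_inverse (NM_egf \<Gamma>) 1 = 1"
    by (rule fps_right_inverse) (simp add: NM_egf_def)
  ultimately show ?thesis
    by simp
qed

definition Gamma22 :: "nat \<Rightarrow> nat list set" where
  "Gamma22 s = {[1, 3, 2, 4], [1, 4, 2, 3], [1..<s + 2]}"

end

theory Submission
  imports Defs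
begin

text \<open>
  The reciprocal of the generating function counts lists of bricks. A brick is an ascending word of
  length at most \<open>s\<close>, and two consecutive bricks either form an ascent at their border or contain a
  match across it. Pairing such lists, with sign \<open>(-1)\<close> to the number of bricks, with a word that
  avoids the patterns, one may move the first brick to the end of the word or the last ascending run
  of the word to the front of the bricks. This sign-reversing involution, which leaves the underlying
  permutation unchanged, shows that the coefficient of \<open>y\<^sup>k\<close> in \<open>U\<^sub>N(-y)\<close> is the number of lists
  of \<open>k\<close> bricks whose concatenation is a permutation of \<open>1, \<dots>, N\<close>.

  For \<open>N = s n\<close> and \<open>n\<close> bricks all bricks have length \<open>s\<close>; for \<open>N = s n + s - 1\<close> and \<open>n + 1\<close> bricks
  exactly one has length \<open>s - 1\<close>. For bricks of length at least two, the border condition says that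
  the last but one entry of a brick is smaller than the first entry of the next brick. Hence the
  brick lists are the linear extensions of a caterpillar tree whose leaves are the last entries, and
  these can be chosen independently, one after the other.
\<close>

section \<open>Pattern matches as forbidden consecutive factors\<close>

lemma red_distinct:
  assumes "distinct r"
  shows "red r = map (\<lambda>x. length (filter (\<lambda>y. y \<le> x) r)) r"
proof -
  have "card {y \<in> set r. y \<le> x} = length (filter (\<lambda>y. y \<le> x) r)" for x
    using assms by (metis distinct_card distinct_filter set_filter)
  then show ?thesis by (simp add: red_def)
qed

lemma length_red [simp]: "length (red r) = length r"
  by (simp add: red_def)

lemma red_sorted_distinct: "sorted r \<Longrightarrow> distinct r \<Longrightarrow> red r = [1..<length r + 1]"
proof (induction r rule: rev_induct)
  case Nil
  then show ?case by (simp add: red_def)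
next
  case (snoc x r)
  have lt: "y < x" if "y \<in> set r" for y
    using snoc.prems that by (auto simp: sorted_append intro!: le_neq_implies_less)
  have IH: "red r = [1..<length r + 1]"
    using snoc by (simp add: sorted_append)
  have "filter (\<lambda>y. y \<le> x) (r @ [x]) = r @ [x]"
    using lt by (auto simp: less_imp_le)
  moreover have "filter (\<lambda>y. y \<le> z) (r @ [x]) = filter (\<lambda>y. y \<le> z) r" if "z \<in> set r" for z
    using lt[OF that] by simp
  ultimately have "red (r @ [x]) = red r @ [length r + 1]"
    using snoc.prems by (simp add: red_distinct del: filter_append)
  then show ?case using IH by simp
qed

lemma sorted_of_sorted_red:
  assumes "sorted (red r)"
  shows "sorted r"
proof -
  have "x \<le> y"
    if "x \<in> set r" "y \<in> set r" and le: "card {z \<in> set r. z \<le> x} \<le> card {z \<in> set r. z \<le> y}" for x y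
  proof (rule ccontr)
    assume "\<not> x \<le> y"
    then have "{z \<in> set r. z \<le> y} \<subset> {z \<in> set r. z \<le> x}" using that(1) by auto
    then have "card {z \<in> set r. z \<le> y} < card {z \<in> set r. z \<le> x}"
      by (intro psubset_card_mono) auto
    then show False using le by simp
  qed
  moreover have "sorted_wrt (\<lambda>x y. card {z \<in> set r. z \<le> x} \<le> card {z \<in> set r. z \<le> y}) r"
    using assms by (simp add: red_def sorted_map)
  ultimately show ?thesis by (rule sorted_wrt_mono_rel)
qed

text \<open>
  The two patterns of length four together leave the order of the second and the fourth entry open.
  The ascending pattern is stated with weak inequalities; on distinct entries this is no difference.
\<close>

definition forbidden :: "nat \<Rightarrow> nat list \<Rightarrow> bool" where
  "forbidden s r \<longleftrightarrow>
     (\<exists>a b c d. r = [a, b, c, d] \<and> a < c \<and> c < b \<and> c < d) \<or> (length r = Suc s \<and> sorted r)"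

definition avoids :: "nat \<Rightarrow> nat list \<Rightarrow> bool" where
  "avoids s xs \<longleftrightarrow> (\<forall>p r q. xs = p @ r @ q \<longrightarrow> \<not> forbidden s r)"

lemma red_in_Gamma22_iff:
  assumes "distinct r"
  shows "red r \<in> Gamma22 s \<longleftrightarrow> forbidden s r"
proof -
  have "red r = [1..<s + 2] \<longleftrightarrow> length r = Suc s \<and> sorted r"
  proof
    assume eq: "red r = [1..<s + 2]"
    then have "length (red r) = length [1..<s + 2]" by metis
    moreover have "sorted (red r)" unfolding eq by (rule sorted_upt)
    ultimately show "length r = Suc s \<and> sorted r"
      by (simp add: sorted_of_sorted_red)
  qed (use assms in \<open>simp add: red_sorted_distinct\<close>)
  moreover have "red r = [1, 3, 2, 4] \<or> red r = [1, 4, 2, 3] \<longleftrightarrow>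
    (\<exists>a b c d. r = [a, b, c, d] \<and> a < c \<and> c < b \<and> c < d)" (is "?L \<longleftrightarrow> ?R")
  proof
    assume L: ?L
    then have "length (red r) = 4" by (elim disjE) (simp_all del: length_red)
    then obtain a b c d where "r = [a, b, c, d]"
      by (auto simp: numeral_eq_Suc length_Suc_conv)
    then show ?R using L assms by (auto simp: red_distinct split: if_splits)
  next
    assume ?R
    then show ?L using assms by (auto simp: red_distinct)
  qed
  ultimately show ?thesis by (auto simp: Gamma22_def forbidden_def)
qed

lemma no_match_iff_avoids:
  assumes "distinct xs" "s \<ge> 1"
  shows "(\<forall>i. \<not> match_at (Gamma22 s) xs i) \<longleftrightarrow> avoids s xs"
proof -
  have "\<exists>p r q. xs = p @ r @ q \<and> forbidden s r" if m: "match_at (Gamma22 s) xs i" for i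
  proof -
    obtain j where "red (take (j + 1) (drop i xs)) \<in> Gamma22 s"
      using m unfolding match_at_def by blast
    then have "forbidden s (take (j + 1) (drop i xs))"
      using assms by (simp add: red_in_Gamma22_iff)
    moreover have "xs = take i xs @ take (j + 1) (drop i xs) @ drop (j + 1) (drop i xs)"
      by (metis append_take_drop_id)
    ultimately show ?thesis by blast
  qed
  moreover have "match_at (Gamma22 s) xs (length p)"
    if "xs = p @ r @ q" "forbidden s r" for p r q
  proof -
    \<comment> \<open>A match requires \<open>j \<ge> 1\<close>, hence at least two letters;
      \<open>s \<ge> 1\<close> ensures this for the ascending pattern.\<close>
    have "length r \<ge> 2" using that(2) assms(2) by (auto simp: forbidden_def)
    moreover have "red r \<in> Gamma22 s"
      using that assms red_in_Gamma22_iff by auto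
    ultimately show ?thesis
      using that(1) unfolding match_at_def by (intro exI[of _ "length r - 1"]) auto
  qed
  ultimately show ?thesis unfolding avoids_def by blast
qed

lemma NM_Gamma22: "s \<ge> 1 \<Longrightarrow> NM (Gamma22 s) n = {xs \<in> permutations_of_set {1..n}. avoids s xs}"
  unfolding NM_def using no_match_iff_avoids permutations_of_setD(2) by blast

lemma avoids_appendD:
  assumes "avoids s (xs @ ys)"
  shows "avoids s xs" "avoids s ys"
proof -
  show "avoids s xs" using assms unfolding avoids_def by (metis append.assoc)
  show "avoids s ys" using assms unfolding avoids_def by (metis append.assoc)
qed

lemma avoids_sorted: "sorted xs \<Longrightarrow> length xs \<le> s \<Longrightarrow> avoids s xs"
  unfolding avoids_def forbidden_def by (auto simp: sorted_append)

lemma length_le_if_avoids: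
  assumes "avoids s xs" "sorted xs"
  shows "length xs \<le> s"
proof (rule ccontr)
  assume "\<not> length xs \<le> s"
  then have "length (take (Suc s) xs) = Suc s" by simp
  moreover have "sorted (take (Suc s) xs)" using assms(2) by (rule sorted_wrt_take)
  ultimately have "forbidden s (take (Suc s) xs)" unfolding forbidden_def by blast
  moreover have "xs = [] @ take (Suc s) xs @ drop (Suc s) xs" by simp
  ultimately show False using assms(1) unfolding avoids_def by blast
qed

text \<open>A forbidden factor has to straddle the border, since \<open>u\<close> and
  \<open>b\<close> both avoid. The descent there rules out the ascending pattern, and the only
  descent of a four-letter pattern lies between its second and third letters, so the border cuts it
  in the middle.\<close>

lemma forbidden_across_descent:
  assumes "\<not> avoids s (u @ b)" "avoids s u" "sorted b" "length b \<le> s" "last u > hd b"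
  obtains u' x y c d b' where
    "u = u' @ [x, y]" "b = c # d # b'" "x < c" "c < y" "c < d"
proof -
  obtain p r q where eq: "u @ b = p @ r @ q" and r: "forbidden s r"
    using assms(1) unfolding avoids_def by blast
  have "avoids s b" using assms avoids_sorted by blast
  have not_u: "u \<noteq> p @ r @ t" for t
    using r assms(2) unfolding avoids_def by blast
  have not_b: "b \<noteq> t @ r @ q" for t
    using r \<open>avoids s b\<close> unfolding avoids_def by blast
  obtain r1 r2 where r12: "r = r1 @ r2" "u = p @ r1" "b = r2 @ q" "r1 \<noteq> []" "r2 \<noteq> []"
  proof -
    from eq consider w where "u = p @ w" "w @ b = r @ q" | w where "b = w @ r @ q"
      unfolding append_eq_append_conv2[of u b p] by metis
    then obtain w where w: "u = p @ w" "w @ b = r @ q"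
      using not_b by cases metis+
    from w(2) consider t where "w = r @ t" | r2 where "r = w @ r2" "b = r2 @ q"
      unfolding append_eq_append_conv2[of w b r] by metis
    then obtain r2 where r2: "r = w @ r2" "b = r2 @ q"
      using not_u w(1) by cases metis+
    show thesis
    proof (rule that[OF r2(1) w(1) r2(2)])
      show "w \<noteq> []" using not_b[of "[]"] r2 by auto
      show "r2 \<noteq> []" using not_u[of "[]"] r2 w(1) by auto
    qed
  qed
  have desc: "last r1 > hd r2" using r12 assms(5) by auto
  have "\<not> sorted r"
  proof
    assume "sorted r"
    then have "last r1 \<le> hd r2" using r12 by (simp add: sorted_append)
    then show False using desc by simp
  qed
  then obtain x y c d where xy: "r = [x, y, c, d]" "x < c" "c < y" "c < d"
    using r unfolding forbidden_def by blast
  have "sorted r2" using assms(3) r12 by (simp add: sorted_append)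
  then have "r1 = [x, y]" "r2 = [c, d]"
    using r12(1,4,5) xy desc by (auto simp: Cons_eq_append_conv)
  then show thesis using that r12 xy by simp
qed

section \<open>Last ascending runs and the descent statistic\<close>

lemma last_ascending_run_exists:
  "xs \<noteq> [] \<Longrightarrow> \<exists>u b. xs = u @ b \<and> b \<noteq> [] \<and> sorted b \<and> (u = [] \<or> last u > hd (b :: nat list))"
proof (induction xs)
  case (Cons x xs)
  show ?case
  proof (cases "xs = []")
    case True
    then show ?thesis by (intro exI[of _ "[]"] exI[of _ "[x]"]) auto
  next
    case False
    then obtain u b where *: "xs = u @ b" "b \<noteq> []" "sorted b" "u = [] \<or> last u > hd b"
      using Cons.IH by blast
    show ?thesis
    proof (cases "u = [] \<and> x \<le> hd b")
      case True
      then have "sorted (x # b)" using * by (cases b) auto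
      then show ?thesis using True * by (intro exI[of _ "[]"] exI[of _ "x # b"]) auto
    next
      case False
      then show ?thesis using * by (intro exI[of _ "x # u"] exI[of _ b]) auto
    qed
  qed
qed simp

text \<open>If two decompositions differed, the descent in front of the shorter final piece would
  lie inside the longer, sorted one. Injectivity of the involution rests on this.\<close>

lemma last_ascending_run_unique:
  fixes b b' :: "nat list"
  assumes "u @ b = u' @ b'" "sorted b" "sorted b'" "b \<noteq> []" "b' \<noteq> []"
    "u = [] \<or> last u > hd b" "u' = [] \<or> last u' > hd b'"
  shows "u = u' \<and> b = b'"
proof -
  have aux: "w = []" if "v = v' @ w" "c' = w @ c" "v = [] \<or> last v > hd c" "sorted c'" "c \<noteq> []"
    for v v' w c c' :: "nat list"
  proof (rule ccontr)
    assume "w \<noteq> []"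
    then have "last w > hd c" "last w \<le> hd c" using that by (auto simp: sorted_append)
    then show False by simp
  qed
  from assms(1) consider w where "u = u' @ w" "b' = w @ b" | w where "u' = u @ w" "b = w @ b'"
    by (auto simp: append_eq_append_conv2)
  then show ?thesis
  proof cases
    case 1
    have "w = []" using aux[OF 1 assms(6,3,4)] .
    then show ?thesis using 1 by simp
  next
    case 2
    have "w = []" using aux[OF 2 assms(7,2,5)] .
    then show ?thesis using 2 by simp
  qed
qed

lemma des_Nil [simp]: "des [] = 0" and des_singleton [simp]: "des [x] = 0"
  by (simp_all add: des_def)

lemma des_Cons_Cons [simp]: "des (x # y # zs) = (if x > y then 1 else 0) + des (y # zs)"
proof -
  let ?D = "\<lambda>xs :: nat list. {i. Suc i < length xs \<and> xs ! i > xs ! Suc i}"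
  have fin: "finite (?D xs)" for xs
    by (rule finite_subset[of _ "{..<length xs}"]) auto
  have "?D (x # y # zs) = (if x > y then {0} else {}) \<union> Suc ` ?D (y # zs)"
  proof (rule set_eqI)
    fix i show "i \<in> ?D (x # y # zs) \<longleftrightarrow> i \<in> (if x > y then {0} else {}) \<union> Suc ` ?D (y # zs)"
      by (cases i) auto
  qed
  then show ?thesis
    using fin[of "y # zs"] unfolding des_def by (subst \<open>?D (x # y # zs) = _\<close>) (auto simp: card_insert_if card_image)
qed

lemma des_sorted: "sorted xs \<Longrightarrow> des xs = 0"
  by (induction xs rule: induct_list012) auto

lemma des_append_descent:
  "u \<noteq> [] \<Longrightarrow> b \<noteq> [] \<Longrightarrow> last u > hd b \<Longrightarrow> des (u @ b) = Suc (des u + des b)"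
proof (induction u rule: induct_list012)
  case (2 x)
  then show ?case by (cases b) auto
qed auto

section \<open>Brick lists and the sign-reversing involution\<close>

definition brick :: "nat \<Rightarrow> nat list \<Rightarrow> bool" where
  "brick s b \<longleftrightarrow> b \<noteq> [] \<and> sorted b \<and> length b \<le> s"

text \<open>The negation is the condition for appending \<open>b\<close> to \<open>a\<close> as a
  new run of an avoiding word. A link therefore blocks a second forward move right after a first
  one.\<close>

definition linked :: "nat \<Rightarrow> nat list \<Rightarrow> nat list \<Rightarrow> bool" where
  "linked s a b \<longleftrightarrow> last a \<le> hd b \<or> \<not> avoids s (a @ b)"

definition brick_perms :: "nat \<Rightarrow> nat set \<Rightarrow> nat list list set" where
  "brick_perms s C = {bs. (\<forall>b\<in>set bs. brick s b) \<and> successively (linked s) bs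
     \<and> concat bs \<in> permutations_of_set C}"

definition brick_weight :: "nat \<Rightarrow> nat set \<Rightarrow> rat poly" where
  "brick_weight s C = (\<Sum>bs\<in>brick_perms s C. (monom (-1) 1) ^ length bs)"

text \<open>The exponent of \<open>y\<close> is the number of ascending runs, which is
  \<open>0\<close> for the empty word; this matches the constant term of
  \<open>NM_egf\<close>.\<close>

definition des_weight :: "nat list \<Rightarrow> rat poly" where
  "des_weight u = (if u = [] then 1 else monom 1 (1 + des u))"

definition avoiders :: "nat \<Rightarrow> nat set \<Rightarrow> nat list set" where
  "avoiders s B = {u \<in> permutations_of_set B. avoids s u}"

definition avoider_weight :: "nat \<Rightarrow> nat set \<Rightarrow> rat poly" where
  "avoider_weight s B = (\<Sum>u\<in>avoiders s B. des_weight u)"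

lemma finite_avoiders [simp]: "finite (avoiders s B)"
  unfolding avoiders_def by simp

text \<open>Bricks are non-empty, so a list has at most as many bricks as letters.\<close>

lemma finite_brick_perms:
  assumes "finite C"
  shows "finite (brick_perms s C)"
proof -
  have len: "length bs \<le> length (concat bs)" if "[] \<notin> set bs" for bs :: "nat list list"
    using that
  proof (induction bs)
    case (Cons b bs)
    then show ?case by (cases b) auto
  qed simp
  let ?X = "{b. set b \<subseteq> C \<and> length b \<le> s}"
  have "brick_perms s C \<subseteq> {bs. set bs \<subseteq> ?X \<and> length bs \<le> card C}"
  proof
    fix bs assume bs: "bs \<in> brick_perms s C"
    then have "length bs \<le> length (concat bs)"
      by (intro len) (auto simp: brick_perms_def brick_def)
    also have "\<dots> = card C"
      using bs by (intro length_finite_permutations_of_set) (simp add: brick_perms_def)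
    finally have "length bs \<le> card C" .
    moreover have "set bs \<subseteq> ?X"
      using bs by (auto simp: brick_perms_def brick_def permutations_of_set_def)
    ultimately show "bs \<in> {bs. set bs \<subseteq> ?X \<and> length bs \<le> card C}" by simp
  qed
  moreover have "finite {bs. set bs \<subseteq> ?X \<and> length bs \<le> card C}"
    by (intro finite_lists_length_le assms)
  ultimately show ?thesis by (rule finite_subset)
qed

text \<open>Nothing is required at the border between \<open>u\<close> and the first brick: what
  happens there decides in which direction the involution moves.\<close>

definition split_perms :: "nat \<Rightarrow> nat set \<Rightarrow> (nat list \<times> nat list list) set" where
  "split_perms s A = {(u, bs). avoids s u \<and> (\<forall>b\<in>set bs. brick s b) \<and> successively (linked s) bs
     \<and> u @ concat bs \<in> permutations_of_set A}"

text \<open>\<open>B\<close> is the set of letters of the avoiding word. Summation over all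
  \<open>B\<close> is the combinatorial form of multiplying two exponential generating
  functions.\<close>

lemma split_perms_eq_Union:
  "split_perms s A = (\<Union>B\<in>Pow A. avoiders s B \<times> brick_perms s (A - B))"
proof (intro equalityI subsetI)
  fix z assume "z \<in> split_perms s A"
  then obtain u bs where z: "z = (u, bs)" and *: "avoids s u" "\<forall>b\<in>set bs. brick s b"
    "successively (linked s) bs" "u @ concat bs \<in> permutations_of_set A"
    by (auto simp: split_perms_def)
  from *(4) have "set u \<union> set (concat bs) = A" "distinct u" "distinct (concat bs)"
    "set u \<inter> set (concat bs) = {}"
    by (auto simp: permutations_of_set_def)
  then have "u \<in> permutations_of_set (set u)" "concat bs \<in> permutations_of_set (A - set u)"
    "set u \<in> Pow A"
    by (auto simp: permutations_of_set_def)
  then show "z \<in> (\<Union>B\<in>Pow A. avoiders s B \<times> brick_perms s (A - B))"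
    using * z by (auto simp: avoiders_def brick_perms_def)
next
  fix z assume "z \<in> (\<Union>B\<in>Pow A. avoiders s B \<times> brick_perms s (A - B))"
  then show "z \<in> split_perms s A"
    by (auto simp: avoiders_def brick_perms_def split_perms_def permutations_of_set_def)
qed

lemma finite_split_perms: "finite A \<Longrightarrow> finite (split_perms s A)"
  unfolding split_perms_eq_Union by (auto intro!: finite_cartesian_product finite_brick_perms)

lemma sum_split_perms:
  assumes "finite A"
  shows "(\<Sum>(u, bs)\<in>split_perms s A. des_weight u * (monom (-1) 1) ^ length bs)
    = (\<Sum>B\<in>Pow A. avoider_weight s B * brick_weight s (A - B))"
proof -
  have "(\<Sum>(u, bs)\<in>split_perms s A. des_weight u * (monom (-1) 1) ^ length bs)
    = (\<Sum>B\<in>Pow A. \<Sum>(u, bs)\<in>avoiders s B \<times> brick_perms s (A - B).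
         des_weight u * (monom (-1) 1) ^ length bs)"
    unfolding split_perms_eq_Union
  proof (intro sum.UNION_disjoint ballI impI)
    fix B B' :: "nat set" assume "B \<noteq> B'"
    then show "avoiders s B \<times> brick_perms s (A - B) \<inter> avoiders s B' \<times> brick_perms s (A - B') = {}"
      by (auto simp: avoiders_def permutations_of_set_def)
  qed (use assms in \<open>auto intro!: finite_cartesian_product finite_brick_perms\<close>)
  also have "\<dots> = (\<Sum>B\<in>Pow A. avoider_weight s B * brick_weight s (A - B))"
    by (simp add: avoider_weight_def brick_weight_def sum_product sum.cartesian_product)
  finally show ?thesis .
qed

text \<open>
  The first brick is moved to the end of the avoiding word if it becomes its last ascending run
  there, and the last ascending run is moved back otherwise; both change the sign.
\<close>

lemma sum_split_perms_eq_0: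
  assumes "finite A" "A \<noteq> {}"
  shows "(\<Sum>(u, bs)\<in>split_perms s A. des_weight u * (monom (-1) 1) ^ length bs) = 0"
proof -
  let ?Q = "split_perms s A"
  define w where "w = (\<lambda>(u, bs :: nat list list). des_weight u * (monom (-1) 1) ^ length bs)"
  \<comment> \<open>\<open>M\<close> holds the pairs whose first brick can be moved. For empty
    \<open>u\<close> avoidance is automatic, since a brick is sorted and has length at most
    \<open>s\<close>. The map \<open>\<phi>\<close> performs the move, and its image will be the
    complement of \<open>M\<close>.\<close>
  define M where "M = {(u, bs). (u, bs) \<in> ?Q \<and> bs \<noteq> [] \<and>
    (u = [] \<or> last u > hd (hd bs) \<and> avoids s (u @ hd bs))}"
  define \<phi> where "\<phi> = (\<lambda>(u :: nat list, bs). (u @ hd bs, tl bs))"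
  have "inj_on \<phi> M"
  proof (rule inj_onI)
    fix y z assume yz: "y \<in> M" "z \<in> M" "\<phi> y = \<phi> z"
    obtain u b bs where y: "y = (u, b # bs)" using yz(1) by (cases y) (auto simp: M_def neq_Nil_conv)
    obtain v c cs where z: "z = (v, c # cs)" using yz(2) by (cases z) (auto simp: M_def neq_Nil_conv)
    have "u @ b = v @ c" and tl: "bs = cs" using yz(3) y z by (auto simp: \<phi>_def)
    moreover have "sorted b" "sorted c" "b \<noteq> []" "c \<noteq> []" "u = [] \<or> last u > hd b" "v = [] \<or> last v > hd c"
      using yz y z by (auto simp: M_def split_perms_def brick_def)
    ultimately have "u = v \<and> b = c" by (intro last_ascending_run_unique) auto
    then show "y = z" using y z tl by simp
  qed
  moreover have "\<phi> ` M = ?Q - M"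
  proof (intro equalityI subsetI)
    fix z assume "z \<in> \<phi> ` M"
    then obtain u bs' where z': "z = (u @ hd bs', tl bs')" "(u, bs') \<in> M"
      by (auto simp: \<phi>_def)
    then obtain b bs where "bs' = b # bs" by (auto simp: M_def neq_Nil_conv)
    with z' have z: "z = (u @ b, bs)" and ub: "(u, b # bs) \<in> M" by auto
    have Q: "(u, b # bs) \<in> ?Q" and cond: "u = [] \<or> last u > hd b \<and> avoids s (u @ b)"
      using ub by (auto simp: M_def)
    have b: "brick s b" using Q by (auto simp: split_perms_def)
    then have av: "avoids s (u @ b)" using cond avoids_sorted by (auto simp: brick_def)
    have "z \<in> ?Q" using Q av z by (auto simp: split_perms_def successively_Cons)
    \<comment> \<open>\<open>b\<close> now ends the word, and its link to the next brick prevents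
      that brick from moving too.\<close>
    moreover have "z \<notin> M"
    proof
      assume "z \<in> M"
      then obtain c cs where bs: "bs = c # cs" and c: "last (u @ b) > hd c" "avoids s (u @ b @ c)"
        using z b by (auto simp: M_def neq_Nil_conv brick_def)
      have "linked s b c" using Q bs by (auto simp: split_perms_def)
      moreover have "avoids s (b @ c)" using c(2) by (rule avoids_appendD)
      ultimately show False using c(1) b by (auto simp: linked_def brick_def)
    qed
    ultimately show "z \<in> ?Q - M" by simp
  next
    fix z assume "z \<in> ?Q - M"
    then obtain u bs where z: "z = (u, bs)" and Q: "(u, bs) \<in> ?Q" and M: "(u, bs) \<notin> M"
      by (cases z) auto
    \<comment> \<open>Since \<open>A\<close> is non-empty, an empty word leaves at least one brick,
      and that brick could be moved.\<close>
    have "u \<noteq> []"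
    proof
      assume "u = []"
      then have "bs \<noteq> []" using Q assms(2) by (auto simp: split_perms_def permutations_of_set_def)
      then show False using \<open>u = []\<close> Q M by (simp add: M_def)
    qed
    then obtain v b where u: "u = v @ b" "b \<noteq> []" "sorted b" "v = [] \<or> last v > hd b"
      using last_ascending_run_exists by blast
    have av: "avoids s u" using Q by (simp add: split_perms_def)
    then have "avoids s b" using u(1) avoids_appendD(2) by simp
    then have "brick s b" using u(2,3) length_le_if_avoids by (simp add: brick_def)
    \<comment> \<open>Moving \<open>b\<close> back requires a link to the next brick. Without one
      there is a descent in front of that brick, yet it cannot join \<open>u\<close>, so a match
      crosses the border; this match turns out to begin inside \<open>b\<close>.\<close>
    have "linked s b (hd bs)" if "bs \<noteq> []"
    proof (rule ccontr)
      assume not_linked: "\<not> linked s b (hd bs)"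
      then have desc: "last b > hd (hd bs)" and avb: "avoids s (b @ hd bs)" by (auto simp: linked_def)
      have not_av: "\<not> avoids s (u @ hd bs)"
        using M Q \<open>u \<noteq> []\<close> \<open>bs \<noteq> []\<close> desc u(1,2) by (auto simp: M_def)
      have hd: "sorted (hd bs)" "length (hd bs) \<le> s" "last u > hd (hd bs)"
        using Q \<open>bs \<noteq> []\<close> desc u(1,2) by (auto simp: split_perms_def brick_def)
      obtain u' x y c d b' where
        *: "u = u' @ [x, y]" "hd bs = c # d # b'" "x < c" "c < y" "c < d"
        by (rule forbidden_across_descent[OF not_av av hd])
      \<comment> \<open>Because of \<open>x < c < y\<close> the last two letters of \<open>u\<close>
        form an ascent, so its last run \<open>b\<close> contains both.\<close>
      have "\<exists>t. b = t @ [x, y]"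
      proof (cases b rule: rev_cases)
        case (snoc b1 y')
        then have "v @ b1 = u' @ [x]" "y' = y" using * u(1) by auto
        then show ?thesis using snoc u(4) * by (cases b1 rule: rev_cases) auto
      qed (use u(2) in simp)
      then obtain t where "b @ hd bs = t @ [x, y, c, d] @ b'" using * by auto
      moreover have "forbidden s [x, y, c, d]" using * by (simp add: forbidden_def)
      ultimately show False using avb unfolding avoids_def by blast
    qed
    then have "(v, b # bs) \<in> ?Q"
      using Q u \<open>brick s b\<close> avoids_appendD(1)[of s v b] av
      by (auto simp: split_perms_def successively_Cons)
    then have "(v, b # bs) \<in> M" using u av by (auto simp: M_def)
    then have "\<phi> (v, b # bs) \<in> \<phi> ` M" by (rule imageI)
    then show "z \<in> \<phi> ` M" using z u by (simp add: \<phi>_def)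
  qed
  ultimately have "(\<Sum>z\<in>?Q - M. w z) = (\<Sum>z\<in>M. w (\<phi> z))"
    by (metis sum.reindex comp_apply sum.cong)
  also have "\<dots> = (\<Sum>z\<in>M. - w z)"
  proof (rule sum.cong[OF refl])
    fix z assume "z \<in> M"
    then obtain u b bs where z: "z = (u, b # bs)" and b: "brick s b" and c: "u = [] \<or> last u > hd b"
      by (auto simp: M_def split_perms_def neq_Nil_conv)
    \<comment> \<open>The word gains a run, hence a factor \<open>y\<close>; the list loses a brick,
      hence a factor \<open>-y\<close>.\<close>
    have "des_weight (u @ b) = monom 1 1 * des_weight u"
      using b c by (auto simp: des_weight_def brick_def des_sorted des_append_descent mult_monom)
    moreover have "monom (-1) 1 = - monom (1 :: rat) 1" by (simp add: minus_monom)
    ultimately show "w (\<phi> z) = - w z" using z by (simp add: w_def \<phi>_def)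
  qed
  finally have "(\<Sum>z\<in>?Q - M. w z) + (\<Sum>z\<in>M. w z) = 0" by (simp add: sum_negf)
  moreover have "M \<subseteq> ?Q" by (auto simp: M_def)
  ultimately have "(\<Sum>z\<in>?Q. w z) = 0"
    using sum.subset_diff[of M ?Q w] finite_split_perms[OF assms(1)] by simp
  then show ?thesis by (simp add: w_def)
qed

section \<open>Order isomorphism and the reciprocal series\<close>

lemma forbidden_map:
  assumes "strict_mono_on A h" "set r \<subseteq> A"
  shows "forbidden s (map h r) \<longleftrightarrow> forbidden s r"
proof -
  have less: "h x < h y \<longleftrightarrow> x < y" if "x \<in> A" "y \<in> A" for x y
    using assms(1) that by (rule strict_mono_on_less)
  have le: "h x \<le> h y \<longleftrightarrow> x \<le> y" if "x \<in> A" "y \<in> A" for x y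
    using less[OF that(2,1)] by (simp flip: not_less)
  have "sorted (map h r) \<longleftrightarrow> sorted r"
    unfolding sorted_map
    by (intro iffI; erule sorted_wrt_mono_rel[rotated]) (use assms(2) le in auto)
  then show ?thesis
    using assms(2) unfolding forbidden_def by (auto simp: map_eq_Cons_conv less)
qed

lemma avoids_map:
  assumes "strict_mono_on A h" "set xs \<subseteq> A"
  shows "avoids s (map h xs) \<longleftrightarrow> avoids s xs"
proof -
  have "(\<forall>p r q. map h xs = p @ r @ q \<longrightarrow> \<not> forbidden s r) \<longleftrightarrow>
        (\<forall>p r q. xs = p @ r @ q \<longrightarrow> \<not> forbidden s (map h r))"
    unfolding map_eq_append_conv append_eq_map_conv by metis
  moreover have "set r \<subseteq> A" if "xs = p @ r @ q" for p r q using that assms(2) by auto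
  ultimately show ?thesis unfolding avoids_def using forbidden_map[OF assms(1)] by metis
qed

lemma des_map:
  assumes "strict_mono_on A h" "set xs \<subseteq> A"
  shows "des (map h xs) = des xs"
  using assms(2) by (induction xs rule: induct_list012) (auto simp: strict_mono_on_less[OF assms(1)])

text \<open>Avoidance and descents depend only on the relative order, so the increasing bijection
  from \<open>{1..card B}\<close> onto \<open>B\<close> preserves weights.\<close>

lemma avoider_weight_card:
  assumes "finite B"
  shows "avoider_weight s B = avoider_weight s {1..card B}"
proof -
  obtain h where h: "strict_mono_on {1..card B} h" "h ` {1..card B} = B"
  proof
    \<comment> \<open>Letters count from \<open>1\<close> and list positions from \<open>0\<close>,
      whence the index \<open>i - 1\<close> below.\<close>
    let ?l = "sorted_list_of_set B"
    have len: "length ?l = card B" by simp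
    show "strict_mono_on {1..card B} (\<lambda>i. ?l ! (i - 1))"
      by (rule strict_mono_onI) (use strict_sorted_list_of_set[of B] len in \<open>auto simp: sorted_wrt_iff_nth_less\<close>)
    have "(\<lambda>i. ?l ! (i - 1)) ` {1..card B} = (!) ?l ` (\<lambda>i. i - 1) ` {1..card B}"
      by (simp add: image_image)
    also have "(\<lambda>i. i - 1) ` {1..card B} = {..<length ?l}"
      unfolding len by (auto intro!: image_eqI[of _ _ "Suc _"])
    also have "(!) ?l ` {..<length ?l} = B"
      using assms by (simp add: nth_image lessThan_atLeast0)
    finally show "(\<lambda>i. ?l ! (i - 1)) ` {1..card B} = B" .
  qed
  have inj: "inj_on h {1..card B}" using h(1) by (rule strict_mono_on_imp_inj_on)
  have "permutations_of_set B = map h ` permutations_of_set {1..card B}"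
    using permutations_of_set_image_inj[OF inj] h(2) by simp
  then have "avoiders s B = map h ` avoiders s {1..card B}"
    using avoids_map[OF h(1)] by (auto simp: avoiders_def permutations_of_set_def)
  moreover have "inj_on (map h) (avoiders s {1..card B})"
    using inj by (intro inj_onI) (auto simp: avoiders_def permutations_of_set_def dest: map_inj_on)
  ultimately have "avoider_weight s B = (\<Sum>u\<in>avoiders s {1..card B}. des_weight (map h u))"
    by (simp add: avoider_weight_def sum.reindex)
  also have "\<dots> = avoider_weight s {1..card B}"
    unfolding avoider_weight_def des_weight_def
    by (intro sum.cong refl) (auto simp: avoiders_def permutations_of_set_def des_map[OF h(1)])
  finally show ?thesis .
qed

lemma sum_Pow_card:
  fixes f :: "nat \<Rightarrow> 'a::comm_ring_1"
  assumes "finite A"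
  shows "(\<Sum>B\<in>Pow A. f (card B)) = (\<Sum>k\<le>card A. of_nat (card A choose k) * f k)"
proof -
  have "(\<Sum>B\<in>Pow A. f (card B)) = (\<Sum>k\<le>card A. \<Sum>B\<in>{B \<in> Pow A. card B = k}. f (card B))"
    using assms by (intro sum.group[symmetric]) (auto intro: card_mono)
  also have "\<dots> = (\<Sum>k\<le>card A. of_nat (card A choose k) * f k)"
  proof (rule sum.cong[OF refl])
    fix k
    have "(\<Sum>B\<in>{B \<in> Pow A. card B = k}. f (card B)) = (\<Sum>B\<in>{B. B \<subseteq> A \<and> card B = k}. f k)"
      by (rule sum.cong) auto
    then show "(\<Sum>B\<in>{B \<in> Pow A. card B = k}. f (card B)) = of_nat (card A choose k) * f k"
      using n_subsets[OF assms] by simp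
  qed
  finally show ?thesis .
qed

lemma NM_egf_nth:
  assumes "s \<ge> 1"
  shows "fps_nth (NM_egf (Gamma22 s)) n = smult (1 / fact n) (avoider_weight s {1..n})"
proof (cases "n = 0")
  case True
  have "avoids s []" by (rule avoids_sorted) auto
  then have "avoiders s {} = {[]}" by (auto simp: avoiders_def)
  then show ?thesis using True by (simp add: NM_egf_def avoider_weight_def des_weight_def)
next
  case False
  have "avoider_weight s {1..n} = (\<Sum>\<sigma>\<in>NM (Gamma22 s) n. monom 1 (1 + des \<sigma>))"
    unfolding avoider_weight_def NM_Gamma22[OF assms] avoiders_def des_weight_def
    using False by (intro sum.cong) (auto simp: permutations_of_set_def)
  then show ?thesis using False by (simp add: NM_egf_def)
qed

lemma smult_sum_right: "smult c (\<Sum>x\<in>A. f x) = (\<Sum>x\<in>A. smult c (f x))"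
  by (induction A rule: infinite_finite_induct) (auto simp: smult_add_right)

text \<open>This is \<open>U_egf\<close> coefficientwise, with the factorials gathered into binomial
  coefficients.\<close>

lemma U_recurrence:
  assumes "s \<ge> 1"
  shows "(\<Sum>k\<le>n. of_nat (n choose k) * (avoider_weight s {1..k} * U (Gamma22 s) (n - k)))
    = (if n = 0 then 1 else 0)"
proof -
  let ?U = "U (Gamma22 s)"
  have "(\<Sum>k\<le>n. of_nat (n choose k) * (avoider_weight s {1..k} * ?U (n - k)))
    = (\<Sum>k\<le>n. smult (fact n) (smult (1 / fact k) (avoider_weight s {1..k}) * smult (1 / fact (n - k)) (?U (n - k))))"
  proof (rule sum.cong[OF refl])
    fix k assume "k \<in> {..n}"
    then have "(of_nat (n choose k) :: rat) = fact n * (1 / fact k * (1 / fact (n - k)))"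
      by (simp add: binomial_fact)
    then show "of_nat (n choose k) * (avoider_weight s {1..k} * ?U (n - k)) =
      smult (fact n) (smult (1 / fact k) (avoider_weight s {1..k}) * smult (1 / fact (n - k)) (?U (n - k)))"
      by (simp add: of_nat_poly mult.commute)
  qed
  also have "\<dots> = smult (fact n) (fps_nth (NM_egf (Gamma22 s) *
      Abs_fps (\<lambda>n. smult (1 / fact n) (?U n))) n)"
    by (simp add: fps_mult_nth NM_egf_nth[OF assms] smult_sum_right atMost_atLeast0)
  also have "\<dots> = (if n = 0 then 1 else 0)" by (simp add: U_egf)
  finally show ?thesis .
qed

text \<open>Both sides solve the same recurrence: the involution gives it for
  \<open>brick_weight\<close>, the generating function for \<open>U\<close>. In each, the term
  \<open>B = {}\<close> isolates the value at \<open>C\<close>, because the empty word has weight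
  \<open>1\<close>, and all other terms involve smaller sets.\<close>

lemma brick_weight_eq_U:
  assumes "s \<ge> 1" "finite C"
  shows "brick_weight s C = U (Gamma22 s) (card C)"
  using assms(2)
proof (induction "card C" arbitrary: C rule: less_induct)
  case less
  let ?U = "U (Gamma22 s)" and ?F = "\<lambda>k. avoider_weight s {1..k}"
  have F0: "?F 0 = 1"
    using NM_egf_nth[OF assms(1), of 0] by (simp add: NM_egf_def)
  have split: "(\<Sum>B\<in>Pow C. f B) = f {} + (\<Sum>B\<in>Pow C - {{}}. f B)" for f :: "nat set \<Rightarrow> rat poly"
    using less.prems by (intro sum.remove) auto
  \<comment> \<open>Only for empty \<open>C\<close> is there a pair without a partner: the empty
    word with no bricks.\<close>
  have "(\<Sum>B\<in>Pow C. avoider_weight s B * brick_weight s (C - B)) = (if C = {} then 1 else 0)"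
  proof (cases "C = {}")
    case True
    have "brick_perms s {} = {[]}"
      by (auto simp: brick_perms_def brick_def)
    then show ?thesis using True F0 by (simp add: brick_weight_def)
  next
    case False
    then show ?thesis using sum_split_perms_eq_0[OF less.prems False, of s]
      sum_split_perms[OF less.prems, of s] by simp
  qed
  then have 1: "brick_weight s C + (\<Sum>B\<in>Pow C - {{}}. avoider_weight s B * brick_weight s (C - B))
      = (if C = {} then 1 else 0)"
    using F0 by (simp add: split)
  have "(\<Sum>B\<in>Pow C. ?F (card B) * ?U (card C - card B)) = (if C = {} then 1 else 0)"
    using U_recurrence[OF assms(1), of "card C"] less.prems
      sum_Pow_card[OF less.prems, of "\<lambda>k. ?F k * ?U (card C - k)"] by simp
  then have 2: "?U (card C) + (\<Sum>B\<in>Pow C - {{}}. ?F (card B) * ?U (card C - card B))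
      = (if C = {} then 1 else 0)"
    using F0 by (simp add: split)
  have "(\<Sum>B\<in>Pow C - {{}}. avoider_weight s B * brick_weight s (C - B))
      = (\<Sum>B\<in>Pow C - {{}}. ?F (card B) * ?U (card C - card B))"
  proof (rule sum.cong[OF refl])
    fix B assume B: "B \<in> Pow C - {{}}"
    then have fin: "finite B" using less.prems finite_subset by auto
    have "card (C - B) = card C - card B" using B fin by (simp add: card_Diff_subset)
    moreover have "card B > 0" "card B \<le> card C" using B fin less.prems by (auto simp: card_gt_0_iff card_mono)
    ultimately have "brick_weight s (C - B) = ?U (card C - card B)"
      using less.hyps[of "C - B"] less.prems by simp
    then show "avoider_weight s B * brick_weight s (C - B) = ?F (card B) * ?U (card C - card B)"
      using avoider_weight_card[OF fin] by simp
  qed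
  with 1 2 show ?case by (metis add_right_cancel)
qed

text \<open>\<open>[:0, -1:]\<close> is \<open>-y\<close>. Substituting it turns the factor
  \<open>-y\<close> of each brick into \<open>y\<close>, so the signs disappear and each coefficient
  is a cardinality.\<close>

lemma coeff_brick_weight:
  assumes "finite C"
  shows "coeff (pcompose (brick_weight s C) [:0, -1:]) k
    = of_nat (card {bs \<in> brick_perms s C. length bs = k})"
proof -
  have "pcompose ((monom (-1) 1) ^ m) [:0, -1:] = [:0, 1 :: rat:] ^ m" for m
    by (induction m) (simp_all add: pcompose_1 pcompose_mult pcompose_pCons pcompose_uminus monom_Suc monom_0)
  then have "pcompose ((monom (-1) 1) ^ m) [:0, -1:] = monom (1 :: rat) m" for m
    by (simp add: monom_altdef)
  then have "coeff (pcompose (brick_weight s C) [:0, -1:]) k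
    = (\<Sum>bs\<in>brick_perms s C. if length bs = k then 1 else 0)"
    unfolding brick_weight_def by (simp add: pcompose_sum coeff_sum)
  also have "\<dots> = of_nat (card {bs \<in> brick_perms s C. length bs = k})"
    using finite_brick_perms[OF assms] by (simp add: sum.If_cases Int_def)
  finally show ?thesis .
qed

section \<open>Brick lists with prescribed lengths\<close>

abbreviation chained :: "nat list \<Rightarrow> nat list \<Rightarrow> bool" where
  "chained a b \<equiv> last (butlast a) < hd b"

text \<open>Let \<open>a\<close> end in \<open>x < y\<close> and \<open>b\<close> begin with
  \<open>c < d\<close>. If \<open>y \<le> c\<close>, then \<open>x < c\<close> as well; if
  \<open>y > c\<close>, the only possible match across the border is \<open>[x, y, c, d]\<close>,
  and it is one exactly when \<open>x < c\<close>.\<close>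

lemma linked_iff_chained:
  assumes "brick s a" "brick s b" "length a \<ge> 2" "length b \<ge> 2" "distinct (a @ b)"
  shows "linked s a b \<longleftrightarrow> chained a b"
proof -
  obtain a' x y where a: "a = a' @ [x, y]"
    using assms(3) by (cases a rule: rev_cases; cases "butlast a" rule: rev_cases) auto
  obtain c d b' where b: "b = c # d # b'"
    using assms(4) by (cases b; cases "tl b") auto
  have "x < y" "c < d" "x \<noteq> c" "y \<noteq> c"
    using assms(1,2,5) a b by (auto simp: brick_def sorted_append)
  show ?thesis
  proof (cases "y \<le> c")
    case True
    then show ?thesis using a b \<open>x < y\<close> by (simp add: linked_def butlast_append)
  next
    case False
    have "avoids s a" using assms(1) avoids_sorted by (simp add: brick_def)
    have "x < c" if "\<not> avoids s (a @ b)"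
      using forbidden_across_descent[OF that \<open>avoids s a\<close>] assms(2) False a b
      by (auto simp: brick_def)
    moreover have "\<not> avoids s (a @ b)" if "x < c"
    proof -
      have "forbidden s [x, y, c, d]"
        using that False \<open>c < d\<close> \<open>y \<noteq> c\<close> by (auto simp: forbidden_def)
      moreover have "a @ b = a' @ [x, y, c, d] @ b'" using a b by simp
      ultimately show ?thesis unfolding avoids_def by blast
    qed
    ultimately show ?thesis using False a b by (auto simp: linked_def butlast_append)
  qed
qed

definition tiled :: "nat list \<Rightarrow> nat set \<Rightarrow> nat list list set" where
  "tiled L A = {bs. map length bs = L \<and> (\<forall>b\<in>set bs. sorted b) \<and> successively chained bs
     \<and> concat bs \<in> permutations_of_set A}"

lemma successively_linked_iff_chained:
  "\<forall>b\<in>set bs. brick s b \<and> length b \<ge> 2 \<Longrightarrow> distinct (concat bs) \<Longrightarrow>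
    successively (linked s) bs \<longleftrightarrow> successively chained bs"
proof (induction bs rule: induct_list012)
  case (3 a b bs)
  have "linked s a b \<longleftrightarrow> chained a b"
    using "3.prems" by (intro linked_iff_chained) auto
  then show ?case using 3 by simp
qed simp_all

lemma brick_perms_eq_tiled:
  assumes "\<forall>l\<in>set L. 2 \<le> l \<and> l \<le> s"
  shows "{bs \<in> brick_perms s A. map length bs = L} = tiled L A"
proof -
  have "bs \<in> brick_perms s A \<longleftrightarrow> bs \<in> tiled L A" if L: "map length bs = L" for bs
  proof -
    have len: "\<forall>b\<in>set bs. 2 \<le> length b \<and> length b \<le> s" using assms L by auto
    then have "(\<forall>b\<in>set bs. brick s b) \<longleftrightarrow> (\<forall>b\<in>set bs. sorted b)"
      by (force simp: brick_def)
    then show ?thesis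
      using len L successively_linked_iff_chained[of bs s] permutations_of_setD(2)[of "concat bs" A]
      unfolding brick_perms_def tiled_def by auto
  qed
  then show ?thesis by (auto simp: tiled_def)
qed

text \<open>First entries increase along a chain: \<open>hd b\<close> is at most the last but one
  entry of \<open>b\<close>, which is below the first entry of the next brick. Within a brick
  sortedness suffices.\<close>

lemma hd_le_of_chained:
  "successively chained bs \<Longrightarrow> \<forall>b\<in>set bs. sorted b \<and> length b \<ge> 2 \<Longrightarrow> z \<in> set (concat bs) \<Longrightarrow>
    hd (hd bs) \<le> z"
proof (induction bs rule: induct_list012)
  case (2 b)
  then show ?case by (cases b) auto
next
  case (3 b c bs)
  obtain x b' where b: "b = x # b'" "b' \<noteq> []"
    using "3.prems"(2) by (cases b; cases "tl b") auto
  show ?case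
  proof (cases "z \<in> set b")
    case True
    then show ?thesis using "3.prems" b by auto
  next
    case False
    then have "hd c \<le> z" using 3 by auto
    moreover have "last (butlast b) \<in> set b" using b by (auto intro: in_set_butlastD)
    then have "x \<le> last (butlast b)" using "3.prems"(2) b by auto
    ultimately show ?thesis using "3.prems"(1) b by auto
  qed
qed simp

text \<open>Each factor counts the candidates for the last entry of a brick: its other entries are
  the smallest letters available, which leaves one letter more than the \<open>sum_list L\<close>
  letters of the later bricks.\<close>

primrec leaf_choices :: "nat list \<Rightarrow> nat" where
  "leaf_choices [] = 1"
| "leaf_choices (l # L) = (1 + sum_list L) * leaf_choices L"

text \<open>Positivity later yields finiteness, as a set of positive cardinality is finite.\<close>

lemma leaf_choices_pos: "leaf_choices L > 0"
  by (induction L) auto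

text \<open>
  In a chained list of bricks all but the last entry of the first brick are smaller than everything
  else, while this last entry is arbitrary among the remaining ones.
\<close>

lemma tiled_Cons:
  assumes "finite A" "card A = l + sum_list L" "\<forall>k\<in>set (l # L). k \<ge> 2"
    and m: "m = take (l - 1) (sorted_list_of_set A)"
    and R: "R = set (drop (l - 1) (sorted_list_of_set A))"
  shows "tiled (l # L) A = (\<lambda>(x, bs). (m @ [x]) # bs) ` (SIGMA x:R. tiled L (R - {x}))"
proof -
  have "m @ drop (l - 1) (sorted_list_of_set A) = sorted_list_of_set A" by (simp add: m)
  then have sd: "sorted (m @ drop (l - 1) (sorted_list_of_set A))"
      "distinct (m @ drop (l - 1) (sorted_list_of_set A))"
      "set (m @ drop (l - 1) (sorted_list_of_set A)) = A"
    using assms(1) by simp_all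
  have lm: "length m = l - 1" using assms(2) by (simp add: m)
  then have "m \<noteq> []" using assms(3) by auto
  have mR: "y < z" if "y \<in> set m" "z \<in> R" for y z
  proof -
    have "y \<le> z" "y \<noteq> z" using sd that by (auto simp: sorted_append R)
    then show ?thesis by simp
  qed
  have "distinct m" "sorted m" "set m \<union> R = A" "set m \<inter> R = {}"
    using sd by (auto simp: sorted_append R)
  show ?thesis
  proof (intro equalityI subsetI)
    fix z assume z: "z \<in> tiled (l # L) A"
    then obtain b bs where zb: "z = b # bs" by (cases z) (auto simp: tiled_def)
    have t: "length b = l" "map length bs = L" "sorted b" "\<forall>c\<in>set bs. sorted c"
      "successively chained bs" "bs \<noteq> [] \<longrightarrow> chained b (hd bs)" "distinct b" "distinct (concat bs)"
      "set b \<union> set (concat bs) = A" "set b \<inter> set (concat bs) = {}"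
      using z zb by (auto simp: tiled_def successively_Cons permutations_of_set_def)
    obtain b' x where b: "b = b' @ [x]" "b' \<noteq> []"
    proof (cases b rule: rev_cases)
      case (snoc ys y)
      then have "ys \<noteq> []" using t(1) assms(3) by auto
      then show thesis using that snoc by blast
    qed (use t(1) assms(3) in auto)
    \<comment> \<open>All of \<open>T\<close> exceeds all of \<open>b'\<close>, so sorting
      \<open>A\<close> gives \<open>b'\<close> followed by sorted \<open>T\<close>; this identifies
      \<open>b'\<close> with \<open>m\<close> and \<open>T\<close> with \<open>R\<close>.\<close>
    define T where "T = insert x (set (concat bs))"
    have lt: "y < w" if "y \<in> set b'" "w \<in> T" for y w
    proof (cases "w = x")
      case True
      then show ?thesis using t(3,7) b(1) that(1) by (auto simp: sorted_append order.strict_iff_order)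
    next
      case False
      then have w: "w \<in> set (concat bs)" using that(2) by (simp add: T_def)
      then have "bs \<noteq> []" by auto
      have "hd (hd bs) \<le> w" using hd_le_of_chained[OF t(5) _ w] t(2,4) assms(3) by auto
      moreover have "last b' < hd (hd bs)" using t(6) \<open>bs \<noteq> []\<close> b by simp
      moreover have "y \<le> last b'"
        using t(3) b that(1) by (cases b' rule: rev_cases) (auto simp: sorted_append)
      ultimately show ?thesis by simp
    qed
    have "finite T" by (simp add: T_def)
    moreover have "sorted b'" "distinct b'" "A = set b' \<union> T" "set b' \<inter> T = {}"
      using t(3,7,9,10) b(1) by (auto simp: sorted_append T_def)
    ultimately have "sorted_list_of_set A = b' @ sorted_list_of_set T"
      using lt assms(1)
      by (intro sorted_distinct_set_unique) (auto simp: sorted_append less_imp_le)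
    then have "m = b'" "drop (l - 1) (sorted_list_of_set A) = sorted_list_of_set T"
      using t(1) b(1) by (auto simp: m)
    then have "m = b'" "R = T" using \<open>finite T\<close> by (auto simp: R)
    moreover have "x \<in> T" "T - {x} = set (concat bs)"
      using t(10) b(1) by (auto simp: T_def)
    ultimately show "z \<in> (\<lambda>(x, bs). (m @ [x]) # bs) ` (SIGMA x:R. tiled L (R - {x}))"
      using t zb b(1) by (auto simp: tiled_def permutations_of_set_def intro!: image_eqI[of _ _ "(x, bs)"])
  next
    fix z assume "z \<in> (\<lambda>(x, bs). (m @ [x]) # bs) ` (SIGMA x:R. tiled L (R - {x}))"
    then obtain x bs where z: "z = (m @ [x]) # bs" and x: "x \<in> R" and bs: "bs \<in> tiled L (R - {x})"
      by auto
    have set_bs: "set (concat bs) = R - {x}" using bs by (simp add: tiled_def permutations_of_set_def)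
    \<comment> \<open>Conversely, the chain condition at the first border is automatic, since all of
      \<open>m\<close> lies below all of \<open>R\<close>.\<close>
    have "last m < hd (hd bs)" if "bs \<noteq> []"
    proof -
      have "length (hd bs) \<in> set L" using bs that by (auto simp: tiled_def)
      then have "hd bs \<noteq> []" using assms(3) by force
      then have "hd (hd bs) \<in> set (concat bs)" using that by (auto intro!: bexI[of _ "hd bs"])
      then show ?thesis using mR \<open>m \<noteq> []\<close> unfolding set_bs by simp
    qed
    then have "successively chained z"
      using bs z by (auto simp: tiled_def successively_Cons)
    moreover have "concat z \<in> permutations_of_set A"
      using z set_bs bs x \<open>distinct m\<close> \<open>set m \<union> R = A\<close> \<open>set m \<inter> R = {}\<close>
      by (auto simp: tiled_def permutations_of_set_def)
    moreover have "sorted (m @ [x])" using \<open>sorted m\<close> mR x by (auto simp: sorted_append less_imp_le)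
    moreover have "length (m @ [x]) = l" using lm assms(3) by auto
    ultimately show "z \<in> tiled (l # L) A" using z bs by (auto simp: tiled_def)
  qed
qed

lemma card_tiled:
  assumes "finite A" "card A = sum_list L" "\<forall>l\<in>set L. l \<ge> 2"
  shows "card (tiled L A) = leaf_choices L"
  using assms
proof (induction L arbitrary: A)
  case Nil
  then have "tiled [] A = {[]}" by (auto simp: tiled_def)
  then show ?case by simp
next
  case (Cons l L)
  define m where "m = take (l - 1) (sorted_list_of_set A)"
  define R where "R = set (drop (l - 1) (sorted_list_of_set A))"
  have "distinct (drop (l - 1) (sorted_list_of_set A))" by simp
  then have cardR: "card R = 1 + sum_list L"
    using Cons.prems unfolding R_def by (subst distinct_card) auto
  have IH: "card (tiled L (R - {x})) = leaf_choices L" if "x \<in> R" for x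
    using that cardR Cons.prems by (intro Cons.IH) (auto simp: R_def)
  have "inj_on (\<lambda>(x, bs). (m @ [x]) # bs) (SIGMA x:R. tiled L (R - {x}))"
    by (auto simp: inj_on_def)
  then have "card (tiled (l # L) A) = card (SIGMA x:R. tiled L (R - {x}))"
    using tiled_Cons[OF Cons.prems(1) _ Cons.prems(3) m_def R_def] Cons.prems(2) by (simp add: card_image)
  also have "\<dots> = (\<Sum>x\<in>R. card (tiled L (R - {x})))"
    using IH leaf_choices_pos[of L] by (intro card_SigmaI) (auto simp: R_def intro!: card_ge_0_finite)
  also have "\<dots> = leaf_choices (l # L)" using IH cardR by simp
  finally show ?case .
qed

section \<open>Possible brick lengths and the product formulas\<close>

lemma sum_list_le_mult_length:
  fixes L :: "nat list"
  shows "\<forall>l\<in>set L. l \<le> s \<Longrightarrow> sum_list L \<le> s * length L"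
  by (induction L) auto

lemma eq_replicate_of_sum_list:
  fixes L :: "nat list"
  shows "\<forall>l\<in>set L. l \<le> s \<Longrightarrow> sum_list L = s * length L \<Longrightarrow> L = replicate (length L) s"
proof (induction L)
  case (Cons l L)
  then have "sum_list L \<le> s * length L" "l \<le> s" using sum_list_le_mult_length by auto
  then have "l = s" "sum_list L = s * length L" using Cons.prems(2) by auto
  then show ?case using Cons by simp
qed simp

text \<open>\<open>p\<close> counts the full bricks behind the short one, so that prepending a full
  brick leaves \<open>p\<close> unchanged.\<close>

abbreviation one_short :: "nat \<Rightarrow> nat \<Rightarrow> nat \<Rightarrow> nat list" where
  "one_short s n p \<equiv> replicate (n - p) s @ (s - 1) # replicate p s"

text \<open>The total falls one below its upper bound, so exactly one entry is short, and by one
  only.\<close>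

lemma eq_one_short_of_sum_list:
  "\<forall>l\<in>set L. l \<le> s \<Longrightarrow> length L = Suc n \<Longrightarrow> Suc (sum_list L) = s * Suc n \<Longrightarrow>
    \<exists>p\<le>n. L = one_short s n p"
proof (induction L arbitrary: n)
  case (Cons l L)
  have le: "sum_list L \<le> s * n" "l \<le> s" using Cons.prems sum_list_le_mult_length[of L s] by auto
  show ?case
  proof (cases "l = s")
    case True
    then have sum: "Suc (sum_list L) = s * n" using Cons.prems by simp
    then obtain n' where n': "n = Suc n'" by (cases n) auto
    then obtain p where "p \<le> n'" "L = one_short s n' p"
      using Cons.IH[of n'] Cons.prems sum by auto
    then show ?thesis using n' True by (intro exI[of _ p]) (auto simp: Suc_diff_le)
  next
    case False
    then have "l = s - 1" "sum_list L = s * n" using le Cons.prems(3) by auto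
    then show ?thesis
      using eq_replicate_of_sum_list[of L s] Cons.prems by (intro exI[of _ n]) auto
  qed
qed simp

lemma leaf_choices_replicate: "leaf_choices (replicate n s) = (\<Prod>i=1..n. (i - 1) * s + 1)"
  by (induction n) (auto simp: sum_list_replicate)

text \<open>On the left the factors for \<open>i = 1\<close> and \<open>i = 2\<close> are
  \<open>1\<close> and \<open>s + 1\<close>; the others are those on the right with the index
  shifted by two.\<close>

lemma prod_shift: "(\<Prod>i=1..n + 2. (i - 1) * s + 1) = (s + 1) * (\<Prod>i=1..n. (i + 1) * s + (1 :: nat))"
proof (induction n)
  case 0
  then show ?case by (simp add: numeral_2_eq_2)
next
  case (Suc n)
  have "(\<Prod>i=1..Suc n + 2. (i - 1) * s + 1) = (\<Prod>i=1..n + 2. (i - 1) * s + 1) * ((n + 2) * s + 1)"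
    by simp
  moreover have "(\<Prod>i=1..Suc n. (i + 1) * s + 1) = (\<Prod>i=1..n. (i + 1) * s + 1) * ((n + 2) * s + 1)"
    by simp
  ultimately show ?case by (simp only: Suc.IH mult.assoc)
qed

lemma sum_list_one_short:
  assumes "s \<ge> 1" "p \<le> n"
  shows "Suc (sum_list (one_short s n p)) = s * Suc n"
proof -
  have "Suc (sum_list (one_short s n p)) = (n - p) * s + s + p * s"
    using assms(1) by (simp add: sum_list_replicate)
  also have "\<dots> = ((n - p) + p) * s + s" by (simp add: add_mult_distrib)
  finally show ?thesis using assms(2) by (simp add: mult.commute)
qed

text \<open>Induction on \<open>n\<close>; let \<open>P\<close> be the product for \<open>n\<close>.
  A full brick in front has the factor \<open>s * Suc n\<close>, and these terms add up to
  \<open>s * Suc n * P\<close>. The remaining term \<open>p = Suc n\<close> has the short brick in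
  front and equals \<open>(s + 1) * P\<close> by \<open>prod_shift\<close>. The total is
  \<open>((n + 2) * s + 1) * P\<close>.\<close>

lemma sum_leaf_choices_one_short:
  assumes "s \<ge> 1"
  shows "(\<Sum>p\<le>n. leaf_choices (one_short s n p)) = (\<Prod>i=1..n. (i + 1) * s + 1)"
proof (induction n)
  case (Suc n)
  have "leaf_choices (one_short s (Suc n) p) = s * Suc n * leaf_choices (one_short s n p)"
    if "p \<le> n" for p
  proof -
    have "one_short s (Suc n) p = s # one_short s n p" using that by (simp add: Suc_diff_le)
    moreover have "1 + sum_list (one_short s n p) = s * Suc n"
      using sum_list_one_short[OF assms that] by simp
    ultimately show ?thesis by (simp only: leaf_choices.simps)
  qed
  then have "(\<Sum>p\<le>Suc n. leaf_choices (one_short s (Suc n) p))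
    = s * Suc n * (\<Sum>p\<le>n. leaf_choices (one_short s n p)) + leaf_choices (one_short s (Suc n) (Suc n))"
    by (simp add: sum_distrib_left)
  also have "leaf_choices (one_short s (Suc n) (Suc n)) = (\<Prod>i=1..n + 2. (i - 1) * s + 1)"
  proof -
    have "leaf_choices (one_short s (Suc n) (Suc n)) = (1 + Suc n * s) * leaf_choices (replicate (Suc n) s)"
      by (simp add: sum_list_replicate)
    moreover have "(\<Prod>i=1..n + 2. (i - 1) * s + 1) = (\<Prod>i=1..Suc n. (i - 1) * s + 1) * (Suc n * s + 1)"
      by simp
    ultimately show ?thesis by (simp only: leaf_choices_replicate mult.commute add.commute)
  qed
  also have "s * Suc n * (\<Sum>p\<le>n. leaf_choices (one_short s n p)) + \<dots>
    = (\<Prod>i=1..Suc n. (i + 1) * s + 1)"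
    unfolding prod_shift Suc.IH by (simp add: algebra_simps)
  finally show ?case .
qed simp

lemma map_length_brick_perms:
  assumes "bs \<in> brick_perms s C" "finite C"
  shows "\<forall>l\<in>set (map length bs). l \<le> s" "sum_list (map length bs) = card C"
  using assms length_finite_permutations_of_set[of "concat bs" C]
  by (auto simp: brick_perms_def brick_def length_concat)

theorem theorem6:
  fixes s n :: nat
  assumes "s \<ge> 3" and "n \<ge> 1"
  shows "coeff (pcompose (U (Gamma22 s) (s * n)) [:0, -1:]) n
           = of_nat (\<Prod>i=1..n. (i - 1) * s + 1)
       \<and> coeff (pcompose (U (Gamma22 s) (s * n + s - 1)) [:0, -1:]) (n + 1)
           = of_nat (\<Prod>i=1..n. (i + 1) * s + 1)"
proof
  have U: "U (Gamma22 s) N = brick_weight s {1..N}" for N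
    using brick_weight_eq_U[of s "{1..N}"] assms(1) by simp
  \<comment> \<open>\<open>n\<close> bricks of length at most \<open>s\<close> hold
    \<open>s * n\<close> letters only if all of them are full.\<close>
  have "{bs \<in> brick_perms s {1..s * n}. length bs = n} = tiled (replicate n s) {1..s * n}"
  proof -
    have "length bs = n \<longleftrightarrow> map length bs = replicate n s" if "bs \<in> brick_perms s {1..s * n}" for bs
      using map_length_brick_perms[OF that] eq_replicate_of_sum_list[of "map length bs" s]
      by (metis card_atLeastAtMost diff_Suc_1 finite_atLeastAtMost length_map length_replicate)
    then show ?thesis
      using assms(1) by (subst brick_perms_eq_tiled[of _ s, symmetric]) auto
  qed
  moreover have "card (tiled (replicate n s) {1..s * n}) = leaf_choices (replicate n s)"
    using assms(1) by (intro card_tiled) (auto simp: sum_list_replicate)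
  ultimately show "coeff (pcompose (U (Gamma22 s) (s * n)) [:0, -1:]) n
      = of_nat (\<Prod>i=1..n. (i - 1) * s + 1)"
    unfolding U coeff_brick_weight[OF finite_atLeastAtMost] by (simp only: leaf_choices_replicate)

  let ?N = "s * n + s - 1"
  have N: "Suc ?N = s * Suc n" using assms(1) by simp
  have "{bs \<in> brick_perms s {1..?N}. length bs = n + 1} = (\<Union>p\<le>n. tiled (one_short s n p) {1..?N})"
  proof -
    have "length bs = n + 1 \<longleftrightarrow> (\<exists>p\<le>n. map length bs = one_short s n p)"
      if bs: "bs \<in> brick_perms s {1..?N}" for bs
    proof
      assume "length bs = n + 1"
      then show "\<exists>p\<le>n. map length bs = one_short s n p"
        using map_length_brick_perms[OF bs] N by (intro eq_one_short_of_sum_list) auto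
    next
      assume "\<exists>p\<le>n. map length bs = one_short s n p"
      then have "\<exists>p\<le>n. length (map length bs) = length (one_short s n p)" by metis
      then show "length bs = n + 1" by auto
    qed
    \<comment> \<open>By \<open>s \<ge> 3\<close> even the short brick has length at least
      two.\<close>
    moreover have "tiled (one_short s n p) {1..?N}
        = {bs \<in> brick_perms s {1..?N}. map length bs = one_short s n p}" for p
      using assms(1) by (intro brick_perms_eq_tiled[symmetric]) auto
    ultimately show ?thesis by auto
  qed
  moreover have "card (\<Union>p\<le>n. tiled (one_short s n p) {1..?N}) = (\<Sum>p\<le>n. leaf_choices (one_short s n p))"
  proof -
    have card: "card (tiled (one_short s n p) {1..?N}) = leaf_choices (one_short s n p)" if "p \<le> n" for p
    proof (rule card_tiled)
      have "Suc (sum_list (one_short s n p)) = Suc ?N"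
        unfolding N using that assms(1) by (intro sum_list_one_short) auto
      then show "card {1..?N} = sum_list (one_short s n p)" by simp
    qed (use assms(1) in auto)
    have disj: "tiled (one_short s n p) {1..?N} \<inter> tiled (one_short s n q) {1..?N} = {}"
      if "p \<le> n" "q \<le> n" "p \<noteq> q" for p q
    proof -
      \<comment> \<open>At position \<open>n - q\<close> the second list has its short entry,
        whereas the first one, with \<open>p < q\<close>, is still in its initial block of full
        entries.\<close>
      have neq: "one_short s n p \<noteq> one_short s n q" if "p < q" "q \<le> n" for p q
      proof
        assume eq: "one_short s n p = one_short s n q"
        have "one_short s n p ! (n - q) = s" using that by (simp add: nth_append)
        moreover have "one_short s n q ! (n - q) = s - 1" by (simp add: nth_append)
        ultimately show False using eq assms(1) by simp
      qed
      have "one_short s n p \<noteq> one_short s n q"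
        using neq[of p q] neq[of q p] that by (cases "p < q") auto
      then show ?thesis by (auto simp: tiled_def)
    qed
    have "finite (tiled (one_short s n p) {1..?N})" if "p \<le> n" for p
      using card[OF that] leaf_choices_pos by (intro card_ge_0_finite) simp
    then have "card (\<Union>p\<le>n. tiled (one_short s n p) {1..?N})
        = (\<Sum>p\<le>n. card (tiled (one_short s n p) {1..?N}))"
      using disj by (intro card_UN_disjoint) auto
    also have "\<dots> = (\<Sum>p\<le>n. leaf_choices (one_short s n p))"
      by (rule sum.cong[OF refl], rule card) simp
    finally show ?thesis .
  qed
  ultimately show "coeff (pcompose (U (Gamma22 s) ?N) [:0, -1:]) (n + 1)
      = of_nat (\<Prod>i=1..n. (i + 1) * s + 1)"
    unfolding U coeff_brick_weight[OF finite_atLeastAtMost]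
    using sum_leaf_choices_one_short[of s n] assms(1) by simp
qed

end
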